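(* Let $i\in\{1,2\}$, $\varepsilon=(-1)^i$, let $\lambda,\mu\in\mathbb{R}$ be not both zero, and equip $\mathbb{E}_1^4$ with the density $e^{\lambda(x^2+y^2)+\mu(z^2-t^2)}$. Let $\mathcal{S}_i$ be a timelike general rotational surface of first type ($i=1$) or second type ($i=2$) determined by $f,g,\alpha,\beta$ whose meridian curve is parametrized with $g(u)=u$, i.e. the meridian curve is $c_1:x_1(u)=(f(u),0,u,0)$ for $\mathcal{S}_1$ and $c_2:x_2(u)=(f(u),0,0,u)$ for $\mathcal{S}_2$. Then $\mathcal{S}_i$ is weighted minimal if and only if $f$ is a solution on $J$ of the differential equation $$\left(\arctan(f'(u))\right)'=A_2\quad\text{for }\mathcal{S}_1,\qquad\left(\log\left(\frac{1-f'(u)}{1+f'(u)}\right)\right)'=2A_2\quad\text{for }\mathcal{S}_2,$$ where $$A_2=\frac{f(u)\left(\alpha^2\varepsilon+2\left(\alpha^2\lambda f(u)^2+\beta^2\varepsilon\lambda u^2\right)\right)+u\left(\varepsilon\beta^2\left(1-2\mu u^2\right)-2\alpha^2\mu f(u)^2\right)f'(u)}{(\beta u)^2+\varepsilon(\alpha f(u))^2}.$$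
   Context: $\mathbb{E}_1^4$ is $\mathbb{R}^4$ with coordinates $(x,y,z,t)$ and the metric $\langle\,,\rangle=dx^2+dy^2+dz^2-dt^2$. Let $\alpha,\beta>0$ be constants, $J\subset\mathbb{R}$ an open interval, $f,g:J\to\mathbb{R}$ smooth functions of $u$ (primes denote $d/du$), and $v\in[0,2\pi)$. First type: $\mathcal{S}_1: X_1(u,v)=(f\cos(\alpha v),f\sin(\alpha v),g\cosh(\beta v),g\sinh(\beta v))$ with $\alpha^2f^2-\beta^2g^2<0$ and $f'^2+g'^2>0$ on $J$; its meridian curve is $u\mapsto(f(u),0,g(u),0)$. Second type: $\mathcal{S}_2: X_2(u,v)=(f\cos(\alpha v),f\sin(\alpha v),g\sinh(\beta v),g\cosh(\beta v))$ with $f'^2-g'^2<0$ and $\alpha^2f^2+\beta^2g^2>0$ on $J$; its meridian curve is $u\mapsto(f(u),0,0,g(u))$. Both surfaces are timelike. Normal frame of $\mathcal{S}_1$: $n_1^{\mathcal{S}_1}=\frac{1}{\sqrt{f'^2+g'^2}}(g'\cos(\alpha v),g'\sin(\alpha v),-f'\cosh(\beta v),-f'\sinh(\beta v))$, $n_2^{\mathcal{S}_1}=\frac{1}{\sqrt{(\beta g)^2-(\alpha f)^2}}(-\beta g\sin(\alpha v),\beta g\cos(\alpha v),\alpha f\sinh(\beta v),\alpha f\cosh(\beta v))$. Normal frame of $\mathcal{S}_2$: $n_1^{\mathcal{S}_2}=\frac{1}{\sqrt{(\alpha f)^2+(\beta g)^2}}(\beta g\sin(\alpha v),-\beta g\cos(\alpha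 v),\alpha f\cosh(\beta v),\alpha f\sinh(\beta v))$, $n_2^{\mathcal{S}_2}=\frac{1}{\sqrt{g'^2-f'^2}}(g'\cos(\alpha v),g'\sin(\alpha v),f'\sinh(\beta v),f'\cosh(\beta v))$. With $\varepsilon=(-1)^i$, the $j$-th mean curvatures of $\mathcal{S}_i$ ($j\in\{1,2\}$) are the functions $H_j^{\mathcal{S}_i}=0$ if $j\neq i$, and $$H_i^{\mathcal{S}_i}=\frac{(f'g''-f''g')\left((\alpha f)^2+\varepsilon(\beta g)^2\right)-\varepsilon(\alpha^2fg'+\beta^2gf')(-\varepsilon f'^2+g'^2)}{2(-\varepsilon f'^2+g'^2)^{3/2}\left((\alpha f)^2+\varepsilon(\beta g)^2\right)}.$$ For a density $e^\phi$, the $j$-th weighted mean curvature function is $(H_j^{\mathcal{S}_i})_\phi=H_j^{\mathcal{S}_i}-\frac12\frac{d\phi}{dn_j^{\mathcal{S}_i}}$, where $\frac{d\phi}{dn}=d\phi(n)$ is the directional derivative of $\phi$ along $n$ at the point of the surface. The weighted mean curvature vector field is $\overrightarrow{H_\phi^{\mathcal{S}_i}}=(H_1^{\mathcal{S}_i})_\phi n_1^{\mathcal{S}_i}+(H_2^{\mathcal{S}_i})_\phi n_2^{\mathcal{S}_i}$ and the weighted mean curvature is $H_\phi^{\mathcal{S}_i}=\|\overrightarrow{H_\phi^{\mathcal{S}_i}}\|$, with $\|V\|=\sqrt{|\langle V,V\rangle|}$. The surface is weighted minimal if $H_\phi^{\mathcal{S}_i}$ vanishes identically. *)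

theory Defs
  imports "HOL-Analysis.Analysis"
begin

(* The coordinates x, y, z, t of E^4_1 are the components 1, 2, 3, 4 of real^4. *)
definition lorentz :: "real^4 \<Rightarrow> real^4 \<Rightarrow> real" where
  "lorentz p q = p$1 * q$1 + p$2 * q$2 + p$3 * q$3 - p$4 * q$4"

definition lorentz_norm :: "real^4 \<Rightarrow> real" where
  "lorentz_norm p = sqrt \<bar>lorentz p p\<bar>"

lemma vector_4:
  "(vector [a, b, c, d] :: 'a::zero^4)$1 = a"
  "(vector [a, b, c, d] :: 'a::zero^4)$2 = b"
  "(vector [a, b, c, d] :: 'a::zero^4)$3 = c"
  "(vector [a, b, c, d] :: 'a::zero^4)$4 = d"
  unfolding vector_def by simp_all

definition smooth_on_open :: "real set \<Rightarrow> (real \<Rightarrow> real) \<Rightarrow> bool" where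
  "smooth_on_open J f \<longleftrightarrow> (\<forall>k. \<forall>u\<in>J. (deriv ^^ k) f differentiable (at u))"

(* Throughout, the first argument i = 1, 2 is the type of the surface. Type 2 is written
   as the else branch; the argument i is only meaningful in {1, 2}. *)

definition eps :: "nat \<Rightarrow> real" where
  "eps i = (- 1) ^ i"

definition surf ::
  "nat \<Rightarrow> real \<Rightarrow> real \<Rightarrow> (real \<Rightarrow> real) \<Rightarrow> (real \<Rightarrow> real) \<Rightarrow> real \<Rightarrow> real \<Rightarrow> real^4" where
  "surf i \<alpha> \<beta> f g u v =
    (if i = 1
     then vector [f u * cos (\<alpha> * v), f u * sin (\<alpha> * v), g u * cosh (\<beta> * v), g u * sinh (\<beta> * v)]
     else vector [f u * cos (\<alpha> * v), f u * sin (\<alpha> * v), g u * sinh (\<beta> * v), g u * cosh (\<beta> * v)])"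

(* The inequalities say that the first fundamental form is Lorentzian: the left-hand sides are
   <X_v, X_v> and <X_u, X_u> for type 1, <X_u, X_u> and <X_v, X_v> for type 2. *)
definition timelike_rotational_surface ::
  "nat \<Rightarrow> real \<Rightarrow> real \<Rightarrow> (real \<Rightarrow> real) \<Rightarrow> (real \<Rightarrow> real) \<Rightarrow> real set \<Rightarrow> bool" where
  "timelike_rotational_surface i \<alpha> \<beta> f g J \<longleftrightarrow>
    \<alpha> > 0 \<and> \<beta> > 0 \<and> open J \<and> is_interval J \<and> smooth_on_open J f \<and> smooth_on_open J g \<and>
    (if i = 1
     then \<forall>u\<in>J. \<alpha>\<^sup>2 * (f u)\<^sup>2 - \<beta>\<^sup>2 * (g u)\<^sup>2 < 0 \<and> (deriv f u)\<^sup>2 + (deriv g u)\<^sup>2 > 0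
     else \<forall>u\<in>J. (deriv f u)\<^sup>2 - (deriv g u)\<^sup>2 < 0 \<and> \<alpha>\<^sup>2 * (f u)\<^sup>2 + \<beta>\<^sup>2 * (g u)\<^sup>2 > 0)"

definition normal1 ::
  "nat \<Rightarrow> real \<Rightarrow> real \<Rightarrow> (real \<Rightarrow> real) \<Rightarrow> (real \<Rightarrow> real) \<Rightarrow> real \<Rightarrow> real \<Rightarrow> real^4" where
  "normal1 i \<alpha> \<beta> f g u v =
    (if i = 1
     then (1 / sqrt ((deriv f u)\<^sup>2 + (deriv g u)\<^sup>2)) *\<^sub>R
       vector [deriv g u * cos (\<alpha> * v), deriv g u * sin (\<alpha> * v),
               - deriv f u * cosh (\<beta> * v), - deriv f u * sinh (\<beta> * v)]
     else (1 / sqrt ((\<alpha> * f u)\<^sup>2 + (\<beta> * g u)\<^sup>2)) *\<^sub>R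
       vector [\<beta> * g u * sin (\<alpha> * v), - \<beta> * g u * cos (\<alpha> * v),
               \<alpha> * f u * cosh (\<beta> * v), \<alpha> * f u * sinh (\<beta> * v)])"

definition normal2 ::
  "nat \<Rightarrow> real \<Rightarrow> real \<Rightarrow> (real \<Rightarrow> real) \<Rightarrow> (real \<Rightarrow> real) \<Rightarrow> real \<Rightarrow> real \<Rightarrow> real^4" where
  "normal2 i \<alpha> \<beta> f g u v =
    (if i = 1
     then (1 / sqrt ((\<beta> * g u)\<^sup>2 - (\<alpha> * f u)\<^sup>2)) *\<^sub>R
       vector [- \<beta> * g u * sin (\<alpha> * v), \<beta> * g u * cos (\<alpha> * v),
               \<alpha> * f u * sinh (\<beta> * v), \<alpha> * f u * cosh (\<beta> * v)]
     else (1 / sqrt ((deriv g u)\<^sup>2 - (deriv f u)\<^sup>2)) *\<^sub>R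
       vector [deriv g u * cos (\<alpha> * v), deriv g u * sin (\<alpha> * v),
               deriv f u * sinh (\<beta> * v), deriv f u * cosh (\<beta> * v)])"

definition normal ::
  "nat \<Rightarrow> nat \<Rightarrow> real \<Rightarrow> real \<Rightarrow> (real \<Rightarrow> real) \<Rightarrow> (real \<Rightarrow> real) \<Rightarrow> real \<Rightarrow> real \<Rightarrow> real^4" where
  "normal i j \<alpha> \<beta> f g u v = (if j = 1 then normal1 i \<alpha> \<beta> f g u v else normal2 i \<alpha> \<beta> f g u v)"

definition mean_curvature ::
  "nat \<Rightarrow> nat \<Rightarrow> real \<Rightarrow> real \<Rightarrow> (real \<Rightarrow> real) \<Rightarrow> (real \<Rightarrow> real) \<Rightarrow> real \<Rightarrow> real" where
  "mean_curvature i j \<alpha> \<beta> f g u =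
    (if j \<noteq> i then 0
     else let f1 = deriv f u; f2 = deriv (deriv f) u; g1 = deriv g u; g2 = deriv (deriv g) u in
       ((f1 * g2 - f2 * g1) * ((\<alpha> * f u)\<^sup>2 + eps i * (\<beta> * g u)\<^sup>2)
          - eps i * (\<alpha>\<^sup>2 * f u * g1 + \<beta>\<^sup>2 * g u * f1) * (- eps i * f1\<^sup>2 + g1\<^sup>2))
       / (2 * (- eps i * f1\<^sup>2 + g1\<^sup>2) powr (3/2) * ((\<alpha> * f u)\<^sup>2 + eps i * (\<beta> * g u)\<^sup>2)))"

(* The density is exp o phi; phi is the exponent. *)
definition weighted_mean_curvature_component ::
  "(real^4 \<Rightarrow> real) \<Rightarrow> nat \<Rightarrow> nat \<Rightarrow> real \<Rightarrow> real \<Rightarrow> (real \<Rightarrow> real) \<Rightarrow> (real \<Rightarrow> real) \<Rightarrow> real \<Rightarrow> real \<Rightarrow> real"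
where
  "weighted_mean_curvature_component \<phi> i j \<alpha> \<beta> f g u v =
    mean_curvature i j \<alpha> \<beta> f g u
    - 1/2 * frechet_derivative \<phi> (at (surf i \<alpha> \<beta> f g u v)) (normal i j \<alpha> \<beta> f g u v)"

definition weighted_mean_curvature_vector ::
  "(real^4 \<Rightarrow> real) \<Rightarrow> nat \<Rightarrow> real \<Rightarrow> real \<Rightarrow> (real \<Rightarrow> real) \<Rightarrow> (real \<Rightarrow> real) \<Rightarrow> real \<Rightarrow> real \<Rightarrow> real^4"
where
  "weighted_mean_curvature_vector \<phi> i \<alpha> \<beta> f g u v =
    weighted_mean_curvature_component \<phi> i 1 \<alpha> \<beta> f g u v *\<^sub>R normal i 1 \<alpha> \<beta> f g u v
    + weighted_mean_curvature_component \<phi> i 2 \<alpha> \<beta> f g u v *\<^sub>R normal i 2 \<alpha> \<beta> f g u v"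

definition weighted_mean_curvature ::
  "(real^4 \<Rightarrow> real) \<Rightarrow> nat \<Rightarrow> real \<Rightarrow> real \<Rightarrow> (real \<Rightarrow> real) \<Rightarrow> (real \<Rightarrow> real) \<Rightarrow> real \<Rightarrow> real \<Rightarrow> real"
where
  "weighted_mean_curvature \<phi> i \<alpha> \<beta> f g u v =
    lorentz_norm (weighted_mean_curvature_vector \<phi> i \<alpha> \<beta> f g u v)"

definition weighted_minimal ::
  "(real^4 \<Rightarrow> real) \<Rightarrow> nat \<Rightarrow> real \<Rightarrow> real \<Rightarrow> (real \<Rightarrow> real) \<Rightarrow> (real \<Rightarrow> real) \<Rightarrow> real set \<Rightarrow> bool" where
  "weighted_minimal \<phi> i \<alpha> \<beta> f g J \<longleftrightarrow>
    (\<forall>u\<in>J. \<forall>v\<in>{0..<2 * pi}. weighted_mean_curvature \<phi> i \<alpha> \<beta> f g u v = 0)"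

definition quadratic_exponent :: "real \<Rightarrow> real \<Rightarrow> real^4 \<Rightarrow> real" where
  "quadratic_exponent l \<mu> p = l * ((p$1)\<^sup>2 + (p$2)\<^sup>2) + \<mu> * ((p$3)\<^sup>2 - (p$4)\<^sup>2)"

definition A2 :: "nat \<Rightarrow> real \<Rightarrow> real \<Rightarrow> real \<Rightarrow> real \<Rightarrow> (real \<Rightarrow> real) \<Rightarrow> real \<Rightarrow> real" where
  "A2 i l \<mu> \<alpha> \<beta> f u =
    (f u * (\<alpha>\<^sup>2 * eps i + 2 * (\<alpha>\<^sup>2 * l * (f u)\<^sup>2 + \<beta>\<^sup>2 * eps i * l * u\<^sup>2))
     + u * (eps i * \<beta>\<^sup>2 * (1 - 2 * \<mu> * u\<^sup>2) - 2 * \<alpha>\<^sup>2 * \<mu> * (f u)\<^sup>2) * deriv f u)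
    / ((\<beta> * u)\<^sup>2 + eps i * (\<alpha> * f u)\<^sup>2)"

end

theory Submission
  imports Defs
begin

text \<open>
  The differential of the exponent is \<open>2 \<lambda> \<langle>(x, y, 0, 0), _\<rangle> + 2 \<mu> \<langle>(0, 0, z, t), _\<rangle>\<close>, so
  only the radial parts of a normal in the \<open>xy\<close>- and \<open>zt\<close>-planes matter. The normal of index
  \<open>j \<noteq> i\<close> is orthogonal to both radial vectors; as \<open>H\<^sub>j = 0\<close> as well, the corresponding component
  of the weighted mean curvature is zero. The normal of index \<open>i\<close> is the unit normal of
  the meridian curve within its plane, carried along by the rotations; it is spacelike, and its
  radial parts do not depend on \<open>v\<close>. Hence the weighted mean curvature is the absolute value of a
  single function of \<open>u\<close> (\<open>weighted_mean_curvature_eq_abs\<close>).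

  With \<open>g(u) = u\<close> and \<open>W\<^sup>2 = 1 - \<epsilon> f'\<^sup>2\<close> this function factors as
  \<open>- (f'' + \<epsilon> W\<^sup>2 A\<^sub>2) / (2 W\<^sup>3)\<close> (\<open>normal_component_factorization\<close>), so the surface is
  weighted minimal exactly when \<open>f'' = - \<epsilon> W\<^sup>2 A\<^sub>2\<close>. For \<open>i = 1\<close> division by
  \<open>W\<^sup>2 = 1 + f'\<^sup>2\<close> turns \<open>f''\<close> into the derivative of \<open>arctan f'\<close>; for \<open>i = 2\<close> division by
  \<open>W\<^sup>2 = 1 - f'\<^sup>2\<close> turns \<open>- 2 f''\<close> into the derivative of
  \<open>ln ((1 - f') / (1 + f'))\<close>.
\<close>

lemma frechet_derivative_quadratic_exponent:
  "frechet_derivative (quadratic_exponent l \<mu>) (at p) n =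
    2 * l * (p$1 * n$1 + p$2 * n$2) + 2 * \<mu> * (p$3 * n$3 - p$4 * n$4)"
proof -
  have "(quadratic_exponent l \<mu> has_derivative
      (\<lambda>n. 2 * l * (p$1 * n$1 + p$2 * n$2) + 2 * \<mu> * (p$3 * n$3 - p$4 * n$4))) (at p)"
    unfolding quadratic_exponent_def [abs_def]
    by (auto intro!: derivative_eq_intros bounded_linear.has_derivative [OF bounded_linear_vec_nth]
        simp: algebra_simps)
  from frechet_derivative_at [OF this] show ?thesis
    by (metis (no_types, lifting))
qed

text \<open>Both \<open>x\<^sup>2 + y\<^sup>2\<close> and \<open>z\<^sup>2 - t\<^sup>2\<close> are stationary along this normal, because it is orthogonal
  to the radial vectors \<open>(x, y, 0, 0)\<close> and \<open>(0, 0, z, t)\<close>.\<close>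

lemma exponent_derivative_rotational_normal:
  assumes "i \<in> {1, 2}" "j \<in> {1, 2}" "j \<noteq> i"
  shows "frechet_derivative (quadratic_exponent l \<mu>) (at (surf i \<alpha> \<beta> f g u v))
           (normal i j \<alpha> \<beta> f g u v) = 0"
  using assms
  by (auto simp: frechet_derivative_quadratic_exponent surf_def normal_def normal1_def normal2_def
      vector_4 algebra_simps)

text \<open>The parameter \<open>v\<close> cancels through \<open>cos\<^sup>2 + sin\<^sup>2 = cosh\<^sup>2 - sinh\<^sup>2 = 1\<close>. In type 2 the
  exchange of \<open>sinh\<close> and \<open>cosh\<close> flips the sign of the second summand, which compensates for the
  sign of \<open>f'\<close> in the normal; hence one formula serves both types.\<close>

lemma exponent_derivative_meridian_normal:
  assumes "i \<in> {1, 2}"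
  shows "frechet_derivative (quadratic_exponent l \<mu>) (at (surf i \<alpha> \<beta> f g u v))
           (normal i i \<alpha> \<beta> f g u v) =
         2 * (l * f u * deriv g u - \<mu> * g u * deriv f u)
           / sqrt (- eps i * (deriv f u)\<^sup>2 + (deriv g u)\<^sup>2)"
proof -
  have trig: "x * cos a * (c * (y * cos a)) + x * sin a * (c * (y * sin a)) = c * (x * y)"
    for a c x y :: real
  proof -
    have "x * cos a * (c * (y * cos a)) + x * sin a * (c * (y * sin a))
        = c * (x * y) * ((cos a)\<^sup>2 + (sin a)\<^sup>2)"
      by algebra
    also have "\<dots> = c * (x * y)" by (simp only: sin_cos_squared_add2 mult_1_right)
    finally show ?thesis .
  qed
  have hyp: "x * cosh b * (c * (y * cosh b)) - x * sinh b * (c * (y * sinh b)) = c * (x * y)"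
    for b c x y :: real
  proof -
    have "x * cosh b * (c * (y * cosh b)) - x * sinh b * (c * (y * sinh b))
        = c * (x * y) * ((cosh b)\<^sup>2 - (sinh b)\<^sup>2)"
      by algebra
    also have "\<dots> = c * (x * y)" by (simp only: hyperbolic_pythagoras mult_1_right)
    finally show ?thesis .
  qed
  have hyp': "x * sinh b * (c * (y * sinh b)) - x * cosh b * (c * (y * cosh b)) = - (c * (x * y))"
    for b c x y :: real
    using hyp [of x b c y] by linarith
  consider "i = 1" | "i = 2" using assms by blast
  then show ?thesis
  proof cases
    case 1
    have "frechet_derivative (quadratic_exponent l \<mu>) (at (surf i \<alpha> \<beta> f g u v))
           (normal i i \<alpha> \<beta> f g u v) =
        2 * l * (1 / sqrt ((deriv f u)\<^sup>2 + (deriv g u)\<^sup>2) * (f u * deriv g u))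
        + 2 * \<mu> * (1 / sqrt ((deriv f u)\<^sup>2 + (deriv g u)\<^sup>2) * (g u * - deriv f u))"
      using 1
      by (simp only: frechet_derivative_quadratic_exponent surf_def normal_def normal1_def
          vector_4 vector_scaleR_component real_scaleR_def if_True refl trig hyp)
    then show ?thesis using 1 by (simp add: eps_def diff_divide_distrib algebra_simps)
  next
    case 2
    have not1: "((2::nat) = 1) = False" by simp
    have "frechet_derivative (quadratic_exponent l \<mu>) (at (surf i \<alpha> \<beta> f g u v))
           (normal i i \<alpha> \<beta> f g u v) =
        2 * l * (1 / sqrt ((deriv g u)\<^sup>2 - (deriv f u)\<^sup>2) * (f u * deriv g u))
        + 2 * \<mu> * - (1 / sqrt ((deriv g u)\<^sup>2 - (deriv f u)\<^sup>2) * (g u * deriv f u))"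
      unfolding 2
      by (simp only: frechet_derivative_quadratic_exponent surf_def normal_def normal2_def not1
          vector_4 vector_scaleR_component real_scaleR_def if_False trig hyp')
    then show ?thesis using 2 by (simp add: eps_def diff_divide_distrib algebra_simps)
  qed
qed

text \<open>\<open>lorentz_norm\<close> also vanishes on nonzero null vectors. As this normal is not null, a multiple
  of it has norm zero only if the coefficient is zero.\<close>

lemma lorentz_meridian_normal:
  assumes "i \<in> {1, 2}" and pos: "- eps i * (deriv f u)\<^sup>2 + (deriv g u)\<^sup>2 > 0"
  shows "lorentz (normal i i \<alpha> \<beta> f g u v) (normal i i \<alpha> \<beta> f g u v) = 1"
proof -
  have *: "lorentz (normal i i \<alpha> \<beta> f g u v) (normal i i \<alpha> \<beta> f g u v)
      = (1 / sqrt (- eps i * (deriv f u)\<^sup>2 + (deriv g u)\<^sup>2))\<^sup>2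
        * (- eps i * (deriv f u)\<^sup>2 + (deriv g u)\<^sup>2)"
  proof -
    consider "i = 1" | "i = 2" using assms by blast
    then show ?thesis
    proof cases
      case 1
      let ?c = "1 / sqrt ((deriv f u)\<^sup>2 + (deriv g u)\<^sup>2)"
      have "lorentz (normal i i \<alpha> \<beta> f g u v) (normal i i \<alpha> \<beta> f g u v)
        = ?c\<^sup>2 * ((deriv g u)\<^sup>2 * ((cos (\<alpha> * v))\<^sup>2 + (sin (\<alpha> * v))\<^sup>2)
           + (deriv f u)\<^sup>2 * ((cosh (\<beta> * v))\<^sup>2 - (sinh (\<beta> * v))\<^sup>2))"
        unfolding 1 lorentz_def normal_def normal1_def
        by (simp only: vector_4 vector_scaleR_component real_scaleR_def if_True refl) algebra
      then show ?thesis by (simp add: hyperbolic_pythagoras eps_def 1 algebra_simps)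
    next
      case 2
      let ?c = "1 / sqrt ((deriv g u)\<^sup>2 - (deriv f u)\<^sup>2)"
      have not1: "((2::nat) = 1) = False" by simp
      have "lorentz (normal i i \<alpha> \<beta> f g u v) (normal i i \<alpha> \<beta> f g u v)
        = ?c\<^sup>2 * ((deriv g u)\<^sup>2 * ((cos (\<alpha> * v))\<^sup>2 + (sin (\<alpha> * v))\<^sup>2)
           - (deriv f u)\<^sup>2 * ((cosh (\<beta> * v))\<^sup>2 - (sinh (\<beta> * v))\<^sup>2))"
        unfolding 2 lorentz_def normal_def normal2_def
        by (simp only: vector_4 vector_scaleR_component real_scaleR_def if_False not1) algebra
      then show ?thesis by (simp add: hyperbolic_pythagoras eps_def 2 algebra_simps)
    qed
  qed
  show ?thesis unfolding * using pos by (simp add: power_divide)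
qed

lemma lorentz_norm_scaleR: "lorentz_norm (c *\<^sub>R p) = \<bar>c\<bar> * lorentz_norm p"
proof -
  have "lorentz (c *\<^sub>R p) (c *\<^sub>R p) = c\<^sup>2 * lorentz p p"
    by (simp add: lorentz_def power2_eq_square algebra_simps)
  then show ?thesis
    by (simp add: lorentz_norm_def abs_mult real_sqrt_mult)
qed

lemma weighted_mean_curvature_eq_abs:
  assumes i: "i \<in> {1, 2}" and pos: "- eps i * (deriv f u)\<^sup>2 + (deriv g u)\<^sup>2 > 0"
  shows "weighted_mean_curvature (quadratic_exponent l \<mu>) i \<alpha> \<beta> f g u v =
    \<bar>mean_curvature i i \<alpha> \<beta> f g u
      - (l * f u * deriv g u - \<mu> * g u * deriv f u)
        / sqrt (- eps i * (deriv f u)\<^sup>2 + (deriv g u)\<^sup>2)\<bar>"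
proof -
  let ?h = "\<lambda>j. weighted_mean_curvature_component (quadratic_exponent l \<mu>) i j \<alpha> \<beta> f g u v"
  have "?h j = 0" if "j \<in> {1, 2}" "j \<noteq> i" for j
    using that exponent_derivative_rotational_normal [OF i that]
    by (simp add: weighted_mean_curvature_component_def mean_curvature_def)
  then have "weighted_mean_curvature_vector (quadratic_exponent l \<mu>) i \<alpha> \<beta> f g u v
      = ?h i *\<^sub>R normal i i \<alpha> \<beta> f g u v"
    using i by (auto simp: weighted_mean_curvature_vector_def)
  then have "weighted_mean_curvature (quadratic_exponent l \<mu>) i \<alpha> \<beta> f g u v = \<bar>?h i\<bar>"
    using lorentz_meridian_normal [OF assms]
    by (simp add: weighted_mean_curvature_def lorentz_norm_scaleR) (simp add: lorentz_norm_def)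
  moreover have "1/2 * (2 * x / y) = x / y" for x y :: real
    by simp
  ultimately show ?thesis
    unfolding weighted_mean_curvature_component_def exponent_derivative_meridian_normal [OF i]
    by (simp only:)
qed

text \<open>Since \<open>\<epsilon>\<^sup>2 = 1\<close>, the denominator of \<open>A\<^sub>2\<close> is \<open>\<epsilon>\<close> times the denominator
  \<open>D = \<alpha>\<^sup>2 f\<^sup>2 + \<epsilon> \<beta>\<^sup>2 u\<^sup>2\<close> of the mean curvature, and
  \<open>A\<^sub>2 = (\<alpha>\<^sup>2 f + \<beta>\<^sup>2 u f') / D + 2 \<epsilon> (\<lambda> f - \<mu> u f')\<close>: the first summand comes from the
  second term of the mean curvature, the other one from the density.\<close>

lemma normal_component_factorization:
  fixes W :: real
  assumes i: "i \<in> {1, 2}"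
    and D: "(\<alpha> * f u)\<^sup>2 + eps i * (\<beta> * u)\<^sup>2 \<noteq> 0"
    and W: "W > 0" "W\<^sup>2 = 1 - eps i * (deriv f u)\<^sup>2"
    and g: "g u = u" "deriv g u = 1" "deriv (deriv g) u = 0"
  shows "mean_curvature i i \<alpha> \<beta> f g u
      - (l * f u * deriv g u - \<mu> * g u * deriv f u)
        / sqrt (- eps i * (deriv f u)\<^sup>2 + (deriv g u)\<^sup>2)
    = - (deriv (deriv f) u + eps i * W\<^sup>2 * A2 i l \<mu> \<alpha> \<beta> f u) / (2 * W ^ 3)"
proof -
  define e where "e = eps i"
  define D where "D = (\<alpha> * f u)\<^sup>2 + e * (\<beta> * u)\<^sup>2"
  define R where "R = \<alpha>\<^sup>2 * f u + \<beta>\<^sup>2 * u * deriv f u"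
  define P where "P = l * f u - \<mu> * u * deriv f u"
  have e: "e * e = 1" using i by (auto simp: e_def eps_def)
  then have e0: "e \<noteq> 0" by auto
  have D0: "D \<noteq> 0" using D by (simp add: D_def e_def)
  have WW: "- e * (deriv f u)\<^sup>2 + 1\<^sup>2 = W\<^sup>2" using W by (simp add: e_def)
  have sq: "sqrt (W\<^sup>2) = W" using W(1) by simp
  have "(W\<^sup>2) powr (3/2) = (W powr 2) powr (3/2)"
    using W(1) by (simp only: powr_numeral)
  also have "\<dots> = W powr 3"
    by (simp add: powr_powr)
  also have "\<dots> = W ^ 3"
    using W(1) by (simp only: powr_numeral)
  finally have pw: "(W\<^sup>2) powr (3/2) = W ^ 3" .
  have A2: "A2 i l \<mu> \<alpha> \<beta> f u = (e * R + 2 * P * D) / (e * D)"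
  proof -
    have "e * D = (\<beta> * u)\<^sup>2 + e * (\<alpha> * f u)\<^sup>2"
      unfolding D_def using e by algebra
    moreover have "f u * (\<alpha>\<^sup>2 * e + 2 * (\<alpha>\<^sup>2 * l * (f u)\<^sup>2 + \<beta>\<^sup>2 * e * l * u\<^sup>2))
        + u * (e * \<beta>\<^sup>2 * (1 - 2 * \<mu> * u\<^sup>2) - 2 * \<alpha>\<^sup>2 * \<mu> * (f u)\<^sup>2) * deriv f u
      = e * R + 2 * P * D"
      unfolding D_def R_def P_def by algebra
    ultimately show ?thesis by (simp add: A2_def e_def)
  qed
  have "mean_curvature i i \<alpha> \<beta> f g u
      = (- deriv (deriv f) u * D - e * R * W\<^sup>2) / (2 * W ^ 3 * D)"
    unfolding mean_curvature_def Let_def g e_def [symmetric] WW pw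
    by (simp add: D_def R_def)
  then have "mean_curvature i i \<alpha> \<beta> f g u
      - (l * f u * deriv g u - \<mu> * g u * deriv f u)
        / sqrt (- eps i * (deriv f u)\<^sup>2 + (deriv g u)\<^sup>2)
      = (- deriv (deriv f) u * D - e * R * W\<^sup>2) / (2 * W ^ 3 * D) - P / W"
    unfolding g e_def [symmetric] WW sq by (simp add: P_def)
  also have "\<dots> = (- deriv (deriv f) u * D - e * R * W\<^sup>2 - 2 * P * W\<^sup>2 * D) / (2 * W ^ 3 * D)"
    using W(1) D0 by (simp add: divide_simps power2_eq_square power3_eq_cube)
  also have "\<dots> = - (deriv (deriv f) u + e * W\<^sup>2 * ((e * R + 2 * P * D) / (e * D))) / (2 * W ^ 3)"
    using W(1) D0 e0 by (simp add: divide_simps) (simp add: algebra_simps)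
  finally show ?thesis by (simp add: A2 e_def)
qed

lemma arctan_comp_has_derivative_iff:
  fixes h :: "real \<Rightarrow> real"
  assumes h: "(h has_real_derivative h') (at u)"
  shows "((\<lambda>u. arctan (h u)) has_real_derivative A) (at u) \<longleftrightarrow> h' = (1 + (h u)\<^sup>2) * A"
proof -
  have d: "((\<lambda>u. arctan (h u)) has_real_derivative h' / (1 + (h u)\<^sup>2)) (at u)"
    by (rule derivative_eq_intros h refl | simp add: divide_inverse)+
  have "1 + (h u)\<^sup>2 > 0" by (simp add: add_pos_nonneg)
  then have "h' / (1 + (h u)\<^sup>2) = A \<longleftrightarrow> h' = (1 + (h u)\<^sup>2) * A"
    by (auto simp: field_simps)
  then show ?thesis using d DERIV_unique [OF d] by metis
qed

lemma ln_quotient_comp_has_derivative_iff: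
  fixes h :: "real \<Rightarrow> real"
  assumes h: "(h has_real_derivative h') (at u)" and less: "(h u)\<^sup>2 < 1"
  shows "((\<lambda>u. ln ((1 - h u) / (1 + h u))) has_real_derivative 2 * A) (at u)
    \<longleftrightarrow> h' = - ((1 - (h u)\<^sup>2) * A)"
proof -
  have bd: "1 - h u > 0" "1 + h u > 0"
    using less by (simp_all add: abs_square_less_1 abs_less_iff)
  then have q: "(1 - h u) / (1 + h u) > 0" by simp
  have q': "((\<lambda>u. (1 - h u) / (1 + h u)) has_real_derivative
      (- h' * (1 + h u) - (1 - h u) * h') / ((1 + h u) * (1 + h u))) (at u)"
    using bd by (auto intro!: derivative_eq_intros h)
  have fac: "1 - (h u)\<^sup>2 = (1 - h u) * (1 + h u)"
    by (simp add: power2_eq_square algebra_simps)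
  have "1 / ((1 - h u) / (1 + h u)) *
        ((- h' * (1 + h u) - (1 - h u) * h') / ((1 + h u) * (1 + h u)))
      = - 2 * h' / (1 - (h u)\<^sup>2)"
    unfolding fac using bd by (simp add: divide_simps) (simp add: algebra_simps)
  then have d: "((\<lambda>u. ln ((1 - h u) / (1 + h u))) has_real_derivative
      - 2 * h' / (1 - (h u)\<^sup>2)) (at u)"
    using DERIV_chain2 [OF DERIV_ln_divide [OF q] q'] by simp
  have "- 2 * h' / (1 - (h u)\<^sup>2) = 2 * A \<longleftrightarrow> h' = - ((1 - (h u)\<^sup>2) * A)"
    using less by (auto simp: field_simps)
  then show ?thesis using d DERIV_unique [OF d] by metis
qed

lemma deriv_identity_on_open:
  fixes g :: "real \<Rightarrow> real"
  assumes J: "open J" "u \<in> J" and g: "\<forall>u\<in>J. g u = u"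
  shows "deriv g u = 1" "deriv (deriv g) u = 0"
proof -
  have g': "deriv g u = 1" if "u \<in> J" for u
  proof -
    have "\<forall>\<^sub>F x in nhds u. g x = x"
      using J(1) that g by (auto simp: eventually_nhds)
    from deriv_cong_ev [OF this refl] show ?thesis by simp
  qed
  show "deriv g u = 1" using g' J(2) .
  have "\<forall>\<^sub>F x in nhds u. deriv g x = 1"
    using J g' by (auto simp: eventually_nhds)
  from deriv_cong_ev [OF this refl] show "deriv (deriv g) u = 0" by simp
qed

lemma smooth_on_open_deriv_has_derivative:
  assumes "smooth_on_open J f" "u \<in> J"
  shows "(deriv f has_real_derivative deriv (deriv f) u) (at u)"
proof -
  have "(deriv ^^ 1) f differentiable (at u)"
    using assms unfolding smooth_on_open_def by blast
  then show ?thesis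
    by (simp add: DERIV_deriv_iff_real_differentiable)
qed

theorem theorem5:
  fixes i :: nat and l \<mu> \<alpha> \<beta> :: real and f g :: "real \<Rightarrow> real" and J :: "real set"
  assumes "i \<in> {1, 2}"
    and "\<not> (l = 0 \<and> \<mu> = 0)"
    and "timelike_rotational_surface i \<alpha> \<beta> f g J"
    and "\<forall>u\<in>J. g u = u"
  shows "weighted_minimal (quadratic_exponent l \<mu>) i \<alpha> \<beta> f g J \<longleftrightarrow>
    (if i = 1
     then \<forall>u\<in>J. ((\<lambda>u. arctan (deriv f u)) has_real_derivative A2 i l \<mu> \<alpha> \<beta> f u) (at u)
     else \<forall>u\<in>J. ((\<lambda>u. ln ((1 - deriv f u) / (1 + deriv f u))) has_real_derivative
                   2 * A2 i l \<mu> \<alpha> \<beta> f u) (at u))"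
proof -
  note surface = assms(3) [unfolded timelike_rotational_surface_def]
  have smooth: "smooth_on_open J f" and J: "open J" using surface by auto
  have curvature_zero_iff:
    "weighted_mean_curvature (quadratic_exponent l \<mu>) i \<alpha> \<beta> f g u v = 0
      \<longleftrightarrow> deriv (deriv f) u = - (eps i * (1 - eps i * (deriv f u)\<^sup>2) * A2 i l \<mu> \<alpha> \<beta> f u)"
    if u: "u \<in> J" for u v
  proof -
    have g: "g u = u" "deriv g u = 1" "deriv (deriv g) u = 0"
      using assms(4) u deriv_identity_on_open [OF J u assms(4)] by auto
    have pos: "1 - eps i * (deriv f u)\<^sup>2 > 0"
      using surface assms(1) u g
      by (auto simp: eps_def add_pos_nonneg split: if_splits)
    have D: "(\<alpha> * f u)\<^sup>2 + eps i * (\<beta> * u)\<^sup>2 \<noteq> 0"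
      using surface assms(1) u g by (fastforce simp: eps_def power_mult_distrib)
    define W where "W = sqrt (1 - eps i * (deriv f u)\<^sup>2)"
    have W: "W > 0" "W\<^sup>2 = 1 - eps i * (deriv f u)\<^sup>2"
      using pos by (simp_all add: W_def)
    have pos': "- eps i * (deriv f u)\<^sup>2 + (deriv g u)\<^sup>2 > 0" using pos g by simp
    show ?thesis
      unfolding weighted_mean_curvature_eq_abs [OF assms(1) pos']
        normal_component_factorization [where g = g and l = l and \<mu> = \<mu>, OF assms(1) D W g]
      using W(1) by (simp add: W(2) [symmetric]) linarith
  qed
  \<comment> \<open>The curvature does not depend on \<open>v\<close>, so testing it at \<open>v = 0\<close> is enough.\<close>
  have minimal_iff: "weighted_minimal (quadratic_exponent l \<mu>) i \<alpha> \<beta> f g J \<longleftrightarrow>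
      (\<forall>u\<in>J. deriv (deriv f) u
         = - (eps i * (1 - eps i * (deriv f u)\<^sup>2) * A2 i l \<mu> \<alpha> \<beta> f u))"
  proof -
    have "(0::real) \<in> {0..<2 * pi}" by simp
    then show ?thesis
      unfolding weighted_minimal_def using curvature_zero_iff by blast
  qed
  consider "i = 1" | "i = 2" using assms(1) by blast
  then show ?thesis
  proof cases
    case 1
    then show ?thesis
      unfolding minimal_iff
      using arctan_comp_has_derivative_iff [OF smooth_on_open_deriv_has_derivative [OF smooth]]
      by (simp add: eps_def algebra_simps)
  next
    case 2
    have "(deriv f u)\<^sup>2 < 1" if "u \<in> J" for u
      using surface that 2 deriv_identity_on_open(1) [OF J that assms(4)] by auto
    then show ?thesis
      unfolding minimal_iff
      using 2 ln_quotient_comp_has_derivative_iff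
        [OF smooth_on_open_deriv_has_derivative [OF smooth]]
      by (simp add: eps_def)
  qed
qed

end
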